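(* Let $Q\subset\mathbb{R}^d_{\ge 0}\setminus\{\mathbf{0}\}$ be a polytope, let $f$ be a continuous and convex function on $Q$, and let $\mu$ be a concave upper bound of $f$ on $Q$. Let $P(f,Q)$ be the perspective relaxation (defined using $\mu$). Then $$\operatorname{vol}(P(f,Q))=\frac{1}{d+2}\int_{Q}\mu(\mathbf{x})\,d\mathbf{x}-\frac{1}{d+2}\int_{Q}f(\mathbf{x})\,d\mathbf{x}.$$
   Context: A concave upper bound of $f$ on $Q$ is a concave function $\mu:Q\to\mathbb{R}$ with $\mu(\mathbf{x})\ge f(\mathbf{x})$ for all $\mathbf{x}\in Q$. For $z>0$ and $\mathbf{x}\in z\cdot Q=\{z\mathbf{q}:\mathbf{q}\in Q\}$ write $\tilde f(\mathbf{x},z):=z f(\mathbf{x}/z)$ and $\tilde\mu(\mathbf{x},z):=z\mu(\mathbf{x}/z)$. The perspective relaxation is $$P(f,Q):=\operatorname{convcl}\{(\mathbf{x},y,z)\in\mathbb{R}^d\times\mathbb{R}\times\mathbb{R}:\ \tilde\mu(\mathbf{x},z)\ge y\ge\tilde f(\mathbf{x},z),\ \mathbf{x}\in z\cdot Q,\ 1\ge z>0\},$$ where $\operatorname{convcl}$ denotes the closure of the convex hull. $\operatorname{vol}$ denotes Lebesgue measure in $\mathbb{R}^{d+2}$, and integrals over $Q$ are with respect to Lebesgue measure in $\mathbb{R}^d$. *)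

theory Defs
  imports "HOL-Analysis.Analysis"
begin

definition concave_upper_bound ::
  "(real ^ 'd) set \<Rightarrow> (real ^ 'd \<Rightarrow> real) \<Rightarrow> (real ^ 'd \<Rightarrow> real) \<Rightarrow> bool" where
  "concave_upper_bound Q f \<mu> \<longleftrightarrow> concave_on Q \<mu> \<and> (\<forall>x\<in>Q. f x \<le> \<mu> x)"

text \<open>Only meaningful for \<open>z > 0\<close> and \<open>x\<close> in the dilate of the domain of \<open>f\<close> by \<open>z\<close>;
  \<open>perspective_relaxation\<close> below uses it only there.\<close>

definition perspective :: "(real ^ 'd \<Rightarrow> real) \<Rightarrow> real ^ 'd \<Rightarrow> real \<Rightarrow> real" where
  "perspective f x z = z * f (x /\<^sub>R z)"

definition perspective_relaxation ::
  "(real ^ 'd \<Rightarrow> real) \<Rightarrow> (real ^ 'd \<Rightarrow> real) \<Rightarrow> (real ^ 'd) set \<Rightarrow> ((real ^ 'd) \<times> real \<times> real) set" where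
  "perspective_relaxation \<mu> f Q =
     closure (convex hull
       {(x, y, z). perspective \<mu> x z \<ge> y \<and> y \<ge> perspective f x z \<and>
                   x \<in> (\<lambda>q. z *\<^sub>R q) ` Q \<and> 1 \<ge> z \<and> z > 0})"

end

theory Submission
  imports Defs
begin

text \<open>
  Let \<open>B = {(q, t). q \<in> Q \<and> f q \<le> t \<le> \<mu> q}\<close> be the region between the two graphs. A point
  \<open>(x, y, z)\<close> satisfies the constraints of the perspective relaxation exactly when
  \<open>0 < z \<le> 1\<close> and \<open>(x, y) / z \<in> B\<close>; so the constraint set is the cone over \<open>B \<times> {1}\<close>,
  truncated at height 1, with its apex removed. Since \<open>f\<close> is convex and \<open>\<mu>\<close> is concave, \<open>B\<close> is
  convex, and so is the cone (\<open>convex_truncated_cone\<close>): the convex hull does nothing, and the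
  closure only adds boundary points of a convex set, which form a null set.

  The slice of the cone at height \<open>z\<close> is the dilate \<open>z B\<close> in dimension \<open>d + 1\<close>, so by Tonelli
  the volume is \<open>vol B \<cdot> \<integral>\<^sub>0\<^sup>1 z\<^sup>d\<^sup>+\<^sup>1 dz = vol B / (d + 2)\<close>
  (\<open>emeasure_truncated_cone\<close>), and \<open>vol B\<close> is the integral of \<open>\<mu> - f\<close> over \<open>Q\<close>
  (\<open>emeasure_graph_region\<close>).

  The function \<open>\<mu>\<close> need be neither continuous nor Borel on the boundary of \<open>Q\<close>. It is
  continuous on the interior, and the frontier of the convex set \<open>Q\<close> is null, so the part of \<open>B\<close>
  over the interior, which is Borel, carries the whole volume. To split the integral of \<open>\<mu> - f\<close>
  into two, \<open>\<mu>\<close> must be integrable; this holds because a concave function on a bounded set with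
  nonempty interior is bounded above (\<open>concave_on_bdd_above\<close>), while \<open>f\<close> bounds it below.
  If the interior of \<open>Q\<close> is empty, every integral over \<open>Q\<close> is zero.
\<close>

section \<open>Truncated cones\<close>

text \<open>
  The cone over \<open>B \<times> {1}\<close> up to height 1, without its apex. The height is the last coordinate,
  and the base point \<open>(x, y)\<close> is spread over the first two components of the triple.
\<close>

definition truncated_cone :: "('a::euclidean_space \<times> real) set \<Rightarrow> ('a \<times> real \<times> real) set" where
  "truncated_cone B = {(x, y, z). 0 < z \<and> z \<le> 1 \<and> (x /\<^sub>R z, y / z) \<in> B}"

lemma convex_truncated_cone:
  assumes "convex B"
  shows "convex (truncated_cone B)"
proof (rule convexI, clarsimp simp: truncated_cone_def)
  fix x x' :: 'a and y y' z z' u v :: real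
  assume uv: "0 \<le> u" "0 \<le> v" "u + v = 1"
    and z: "0 < z" "z \<le> 1" "0 < z'" "z' \<le> 1"
    and B: "(x /\<^sub>R z, y / z) \<in> B" "(x' /\<^sub>R z', y' / z') \<in> B"
  \<comment> \<open>Dividing the combination by its height gives a convex combination of the two base points,
      with weights proportional to \<open>u * z\<close> and \<open>v * z'\<close>.\<close>
  define w where "w = u * z + v * z'"
  have w: "0 < w"
  proof (cases "u = 0")
    case False
    then have "0 < u * z" "0 \<le> v * z'" using uv z by auto
    then show ?thesis by (simp add: w_def)
  qed (use uv z in \<open>simp add: w_def\<close>)
  moreover have "w \<le> 1"
    using convex_bound_le[of z 1 z' u v] uv z by (simp add: w_def)
  moreover have "((u *\<^sub>R x + v *\<^sub>R x') /\<^sub>R w, (u * y + v * y') / w) \<in> B"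
  proof -
    have cancel: "u * z / w * inverse z = u / w" "v * z' / w * inverse z' = v / w"
      "u * z / w * (y / z) = u / w * y" "v * z' / w * (y' / z') = v / w * y'"
      using z by simp_all
    have "(u * z / w) *\<^sub>R (x /\<^sub>R z, y / z) + (v * z' / w) *\<^sub>R (x' /\<^sub>R z', y' / z') \<in> B"
      using uv z w by (intro convexD[OF assms B]) (auto simp: w_def simp flip: add_divide_distrib)
    also have "(u * z / w) *\<^sub>R (x /\<^sub>R z, y / z) + (v * z' / w) *\<^sub>R (x' /\<^sub>R z', y' / z') =
      ((u *\<^sub>R x + v *\<^sub>R x') /\<^sub>R w, (u * y + v * y') / w)"
      unfolding scaleR_Pair add_Pair scaleR_scaleR cancel real_scaleR_def
      by (simp add: scaleR_right_distrib divide_inverse algebra_simps)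
    finally show ?thesis .
  qed
  ultimately show "0 < u * z + v * z' \<and> u * z + v * z' \<le> 1 \<and>
    ((u *\<^sub>R x + v *\<^sub>R x') /\<^sub>R (u * z + v * z'), (u * y + v * y') / (u * z + v * z')) \<in> B"
    by (simp add: w_def)
qed

lemma truncated_cone_borel [measurable]:
  assumes [measurable]: "B \<in> sets borel"
  shows "truncated_cone B \<in> sets borel"
proof -
  have [measurable]: "(\<lambda>w :: 'a \<times> real \<times> real. (fst w /\<^sub>R snd (snd w), fst (snd w) / snd (snd w)))
      \<in> borel \<Otimes>\<^sub>M borel \<Otimes>\<^sub>M borel \<rightarrow>\<^sub>M borel"
    unfolding borel_prod[symmetric] by measurable
  have "truncated_cone B = {w \<in> space (borel \<Otimes>\<^sub>M borel \<Otimes>\<^sub>M borel). 0 < snd (snd w) \<and> snd (snd w) \<le> 1 \<and>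
      (fst w /\<^sub>R snd (snd w), fst (snd w) / snd (snd w)) \<in> B}"
    by (auto simp: truncated_cone_def space_pair_measure)
  also have "\<dots> \<in> sets (borel \<Otimes>\<^sub>M borel \<Otimes>\<^sub>M borel)"
    by measurable
  finally show ?thesis
    unfolding borel_prod .
qed

lemma emeasure_lborel_dilate:
  fixes B :: "'a::euclidean_space set"
  assumes [measurable]: "B \<in> sets borel" and z: "0 < z"
  shows "emeasure lborel {w. w /\<^sub>R z \<in> B} = ennreal (z ^ DIM('a)) * emeasure lborel B"
proof -
  have [measurable]: "{w. w /\<^sub>R z \<in> B} \<in> sets borel"
    by measurable
  have "emeasure lborel {w. w /\<^sub>R z \<in> B} =
      emeasure (density (distr lborel borel (\<lambda>x. 0 + z *\<^sub>R x)) (\<lambda>_. \<bar>z\<bar> ^ DIM('a))) {w. w /\<^sub>R z \<in> B}"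
    using lborel_affine[of z "0::'a"] z by simp
  also have "\<dots> = ennreal (z ^ DIM('a)) * emeasure lborel B"
    using z by (simp add: emeasure_density_const emeasure_distr vimage_def)
  finally show ?thesis .
qed

lemma emeasure_truncated_cone:
  fixes B :: "('a::euclidean_space \<times> real) set"
  assumes [measurable]: "B \<in> sets borel"
  shows "emeasure lborel (truncated_cone B) = emeasure lborel B / ennreal (real DIM('a) + 2)"
proof -
  let ?I = "\<lambda>x y z. indicator (truncated_cone B) (x, y, z) :: ennreal"
  have [measurable]: "truncated_cone B \<in> sets (borel \<Otimes>\<^sub>M borel \<Otimes>\<^sub>M borel)"
    unfolding borel_prod by measurable
  have slice: "(\<integral>\<^sup>+x. \<integral>\<^sup>+y. ?I x y z \<partial>lborel \<partial>lborel) =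
      emeasure lborel B * ennreal (z ^ (DIM('a) + 1) * indicator {0<..1} z)" for z
  proof (cases "0 < z \<and> z \<le> 1")
    case True
    have [measurable]: "{w. w /\<^sub>R z \<in> B} \<in> sets (borel \<Otimes>\<^sub>M borel)"
      unfolding borel_prod by measurable
    have "(\<integral>\<^sup>+x. \<integral>\<^sup>+y. ?I x y z \<partial>lborel \<partial>lborel) =
        (\<integral>\<^sup>+x. \<integral>\<^sup>+y. indicator {w. w /\<^sub>R z \<in> B} (x, y) \<partial>lborel \<partial>lborel)"
      using True by (intro nn_integral_cong) (auto simp: truncated_cone_def divide_inverse_commute split: split_indicator)
    also have "\<dots> = (\<integral>\<^sup>+w. indicator {w. w /\<^sub>R z \<in> B} w \<partial>(lborel \<Otimes>\<^sub>M lborel))"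
      by (rule lborel.nn_integral_fst) (simp add: lborel_prod)
    also have "\<dots> = emeasure lborel {w. w /\<^sub>R z \<in> B}"
      by (simp add: lborel_prod)
    also have "\<dots> = ennreal (z ^ (DIM('a) + 1)) * emeasure lborel B"
      using True by (subst emeasure_lborel_dilate) auto
    finally show ?thesis using True by (simp add: mult.commute)
  qed (auto simp: truncated_cone_def)
  define n where "n = DIM('a) + 1"
  have pow: "(\<integral>\<^sup>+z. ennreal (z ^ n * indicator {0<..1} z) \<partial>lborel) = ennreal (1 / real (Suc n))"
  proof -
    have "(\<integral>\<^sup>+z. ennreal (z ^ n * indicator {0<..1} z) \<partial>lborel) =
       (\<integral>\<^sup>+z. ennreal (z ^ n) * indicator {0..1} z \<partial>lborel)"
      by (intro nn_integral_cong) (auto simp: n_def split: split_indicator)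
    also have "\<dots> = ennreal (1 ^ Suc n / real (Suc n) - 0 ^ Suc n / real (Suc n))"
      by (rule nn_integral_FTC_Icc)
        (auto intro!: derivative_eq_intros simp del: of_nat_Suc power_Suc)
    finally show ?thesis by simp
  qed
  have "emeasure lborel (truncated_cone B) = (\<integral>\<^sup>+w. indicator (truncated_cone B) w \<partial>(lborel \<Otimes>\<^sub>M lborel))"
    by (simp add: lborel_prod)
  also have "\<dots> = (\<integral>\<^sup>+x. \<integral>\<^sup>+p. indicator (truncated_cone B) (x, p) \<partial>(lborel \<Otimes>\<^sub>M lborel) \<partial>lborel)"
    by (subst lborel.nn_integral_fst[symmetric]) (auto simp: lborel_prod)
  also have "\<dots> = (\<integral>\<^sup>+x. \<integral>\<^sup>+z. \<integral>\<^sup>+y. ?I x y z \<partial>lborel \<partial>lborel \<partial>lborel)"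
    by (intro nn_integral_cong lborel_pair.nn_integral_snd[symmetric]) measurable
  \<comment> \<open>The height becomes the outermost variable.\<close>
  also have "\<dots> = (\<integral>\<^sup>+z. \<integral>\<^sup>+x. \<integral>\<^sup>+y. ?I x y z \<partial>lborel \<partial>lborel \<partial>lborel)"
    by (rule lborel_pair.Fubini') measurable
  also have "\<dots> = (\<integral>\<^sup>+z. emeasure lborel B * ennreal (z ^ n * indicator {0<..1} z) \<partial>lborel)"
    by (simp only: slice n_def)
  also have "\<dots> = emeasure lborel B * ennreal (1 / (real DIM('a) + 2))"
    by (subst nn_integral_cmult, measurable) (simp only: pow, simp add: n_def add.commute)
  also have "\<dots> = emeasure lborel B / ennreal (real DIM('a) + 2)"
    by (subst divide_ennreal_def, subst inverse_ennreal) (auto simp: inverse_eq_divide)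
  finally show ?thesis .
qed

lemma enn2real_divide_ennreal:
  assumes "0 < r"
  shows "enn2real (a / ennreal r) = enn2real a / r"
  using assms by (simp add: divide_ennreal_def inverse_ennreal enn2real_mult field_simps)

text \<open>
  The base \<open>B\<close> itself may fail to be Borel; it is enough that it differs from a Borel set \<open>A\<close> by
  part of a null set \<open>N\<close>, since the cone over \<open>N\<close> is null.
\<close>

lemma measure_closure_truncated_cone:
  fixes B :: "('a::euclidean_space \<times> real) set"
  assumes "convex B" and A: "A \<in> sets borel" and N: "N \<in> null_sets lborel"
    and AB: "A \<subseteq> B" "B \<subseteq> A \<union> N"
  shows "measure lebesgue (closure (truncated_cone B)) = measure lborel A / (real DIM('a) + 2)"
proof -
  let ?C = "truncated_cone"
  have [measurable]: "?C A \<in> sets borel" "?C N \<in> sets borel"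
    using A N by (auto intro!: truncated_cone_borel)
  have "?C N \<in> null_sets lborel"
    using N by (auto simp: null_sets_def emeasure_truncated_cone)
  moreover have "frontier (?C B) \<in> null_sets lborel"
    using negligible_convex_frontier[OF convex_truncated_cone[OF \<open>convex B\<close>]]
    by (simp add: negligible_iff_null_sets null_sets_completion_iff)
  ultimately have "?C N \<union> frontier (?C B) \<in> null_sets lborel"
    by (rule null_sets.Un)
  then have "AE w in lborel. w \<notin> ?C N \<union> frontier (?C B)"
    by (rule AE_not_in)
  moreover have "?C A \<subseteq> ?C B" "?C B \<subseteq> ?C A \<union> ?C N"
    using AB by (auto simp: truncated_cone_def)
  moreover have "closure (?C B) = ?C B \<union> frontier (?C B)"
    by (rule closure_Un_frontier)
  ultimately have "AE w in lborel. w \<in> closure (?C B) \<longleftrightarrow> w \<in> ?C A"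
    by (elim eventually_mono) auto
  then have "emeasure lborel (closure (?C B)) = emeasure lborel (?C A)"
    by (rule emeasure_eq_AE) auto
  also have "\<dots> = emeasure lborel A / ennreal (real DIM('a) + 2)"
    using A by (rule emeasure_truncated_cone)
  finally have "measure lborel (closure (?C B)) = enn2real (emeasure lborel A / ennreal (real DIM('a) + 2))"
    by (simp add: measure_def)
  then show ?thesis
    by (subst (asm) enn2real_divide_ennreal) (auto simp: measure_def)
qed

section \<open>The region between two graphs\<close>

text \<open>The part of the band \<open>f \<le> y \<le> g\<close> that lies over \<open>Q\<close>.\<close>

definition graph_region :: "'a set \<Rightarrow> ('a \<Rightarrow> real) \<Rightarrow> ('a \<Rightarrow> real) \<Rightarrow> ('a \<times> real) set" where
  "graph_region Q f g = {(x, y). x \<in> Q \<and> f x \<le> y \<and> y \<le> g x}"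

lemma convex_graph_region:
  assumes f: "convex_on Q f" and g: "concave_on Q g"
  shows "convex (graph_region Q f g)"
proof (rule convexI, clarsimp simp: graph_region_def)
  fix x x' y y' and u v :: real
  assume uv: "0 \<le> u" "0 \<le> v" "u + v = 1" and x: "x \<in> Q" "x' \<in> Q"
    and y: "f x \<le> y" "y \<le> g x" "f x' \<le> y'" "y' \<le> g x'"
  have "f (u *\<^sub>R x + v *\<^sub>R x') \<le> u * f x + v * f x'"
    using f uv x by (auto simp: convex_on_def)
  moreover have "u * g x + v * g x' \<le> g (u *\<^sub>R x + v *\<^sub>R x')"
    using g uv x by (auto simp: concave_on_iff)
  moreover have "u * f x + v * f x' \<le> u * y + v * y'" "u * y + v * y' \<le> u * g x + v * g x'"
    using uv y by (auto intro!: add_mono mult_left_mono)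
  moreover have "u *\<^sub>R x + v *\<^sub>R x' \<in> Q"
    using convexD[OF convex_on_imp_convex[OF f]] uv x by auto
  ultimately show "u *\<^sub>R x + v *\<^sub>R x' \<in> Q \<and> f (u *\<^sub>R x + v *\<^sub>R x') \<le> u * y + v * y' \<and>
      u * y + v * y' \<le> g (u *\<^sub>R x + v *\<^sub>R x')"
    by auto
qed

lemma
  fixes f g :: "'a::euclidean_space \<Rightarrow> real"
  assumes Q[measurable]: "Q \<in> sets borel" and f: "continuous_on Q f" and g: "continuous_on Q g"
  shows graph_region_borel: "graph_region Q f g \<in> sets borel"
    and emeasure_graph_region:
      "emeasure lborel (graph_region Q f g) = (\<integral>\<^sup>+x. ennreal (indicator Q x * (g x - f x)) \<partial>lborel)"
proof -
  \<comment> \<open>Extension by zero makes both functions Borel on the whole space.\<close>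
  define f' where "f' x = indicator Q x * f x" for x
  define g' where "g' x = indicator Q x * g x" for x
  have [measurable]: "f' \<in> borel_measurable borel" "g' \<in> borel_measurable borel"
    using borel_measurable_continuous_on_indicator[OF Q f] borel_measurable_continuous_on_indicator[OF Q g]
    by (simp_all add: f'_def[abs_def] g'_def[abs_def])
  have "graph_region Q f g = {w \<in> space (borel \<Otimes>\<^sub>M borel). fst w \<in> Q \<and> f' (fst w) \<le> snd w \<and> snd w \<le> g' (fst w)}"
    by (auto simp: graph_region_def f'_def g'_def space_pair_measure)
  also have "\<dots> \<in> sets (borel \<Otimes>\<^sub>M borel)"
    by measurable
  finally show *: "graph_region Q f g \<in> sets borel"
    unfolding borel_prod .
  have "emeasure lborel (graph_region Q f g) = emeasure (lborel \<Otimes>\<^sub>M lborel) (graph_region Q f g)"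
    by (simp add: lborel_prod)
  also have "\<dots> = (\<integral>\<^sup>+x. emeasure lborel (Pair x -` graph_region Q f g) \<partial>lborel)"
    using * by (intro lborel.emeasure_pair_measure_alt) (simp only: lborel_prod sets_lborel)
  also have "\<dots> = (\<integral>\<^sup>+x. ennreal (indicator Q x * (g x - f x)) \<partial>lborel)"
  proof (intro nn_integral_cong)
    fix x
    have "Pair x -` graph_region Q f g = (if x \<in> Q then {f x..g x} else {})"
      by (auto simp: graph_region_def)
    then show "emeasure lborel (Pair x -` graph_region Q f g) = ennreal (indicator Q x * (g x - f x))"
      by (simp add: emeasure_lborel_Icc_eq ennreal_neg)
  qed
  finally show "emeasure lborel (graph_region Q f g) = (\<integral>\<^sup>+x. ennreal (indicator Q x * (g x - f x)) \<partial>lborel)" .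
qed

section \<open>Integrability of concave functions\<close>

lemma concave_on_continuous_interior:
  fixes g :: "'a::euclidean_space \<Rightarrow> real"
  assumes g: "concave_on Q g"
  shows "continuous_on (interior Q) g"
proof -
  have "convex_on (interior Q) (\<lambda>x. - g x)"
    using g by (intro convex_on_subset[OF _ interior_subset])
      (auto simp: concave_on_def convex_interior convex_on_imp_convex)
  then have "continuous_on (interior Q) (\<lambda>x. - (- g x))"
    by (intro continuous_on_minus convex_on_continuous) auto
  then show ?thesis by simp
qed

text \<open>
  Around an interior point \<open>c\<close> there is a ball on which \<open>g\<close> is bounded below by compactness. Every
  \<open>x \<in> Q\<close> can be reflected through \<open>c\<close>, with a uniform contraction factor, to a point of that ball,
  and concavity on the segment between the two bounds \<open>g x\<close> by \<open>g c\<close> and the lower bound on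
  the ball.
\<close>

lemma concave_on_bdd_above:
  fixes g :: "'a::euclidean_space \<Rightarrow> real"
  assumes g: "concave_on Q g" and "bounded Q" and "interior Q \<noteq> {}"
  shows "bdd_above (g ` Q)"
proof -
  obtain c e where e: "0 < e" "cball c e \<subseteq> interior Q"
    using \<open>interior Q \<noteq> {}\<close> open_contains_cball[of "interior Q"] by (metis ex_in_conv open_interior)
  then have eQ: "cball c e \<subseteq> Q"
    using interior_subset by blast
  have "continuous_on (interior Q) g"
    using g by (rule concave_on_continuous_interior)
  then have "compact ((\<lambda>x. - g x) ` cball c e)"
    by (intro compact_continuous_image continuous_on_minus continuous_on_subset[OF _ e(2)]) auto
  then obtain m where m: "\<And>x. x \<in> cball c e \<Longrightarrow> - g x \<le> m"
    using compact_imp_bounded[THEN bounded_imp_bdd_above] by (force simp: bdd_above_def)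
  obtain R0 where "\<And>x. x \<in> Q \<Longrightarrow> dist c x \<le> R0"
    using \<open>bounded Q\<close> bounded_any_center by blast
  then obtain R where R: "0 < R" "\<And>x. x \<in> Q \<Longrightarrow> dist c x \<le> R"
    using that[of "max 1 R0"] by (force simp: le_max_iff_disj)
  \<comment> \<open>This factor sends a ball of radius \<open>R\<close> around \<open>c\<close> into \<open>cball c e\<close>.\<close>
  define t where "t = e / R"
  have t: "0 < t" using e R by (simp add: t_def)
  show ?thesis
  proof (rule bdd_aboveI2)
    fix x assume x: "x \<in> Q"
    define x' where "x' = c - t *\<^sub>R (x - c)"
    have "dist c x' = t * dist c x"
      using t by (simp add: x'_def dist_norm norm_minus_commute)
    also have "\<dots> \<le> e"
      using R(2)[OF x] R(1) t mult_left_mono[OF R(2)[OF x], of t] by (simp add: t_def)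
    finally have x': "x' \<in> cball c e" by simp
    have c: "c = (t / (1 + t)) *\<^sub>R x + (1 / (1 + t)) *\<^sub>R x'"
    proof -
      have "(1 + t) *\<^sub>R c = t *\<^sub>R x + x'"
        by (simp add: x'_def algebra_simps)
      then have "(1 / (1 + t)) *\<^sub>R ((1 + t) *\<^sub>R c) = (1 / (1 + t)) *\<^sub>R (t *\<^sub>R x + x')"
        by simp
      then show ?thesis using t by (simp add: scaleR_right_distrib)
    qed
    have "t / (1 + t) * g x + 1 / (1 + t) * g x' \<le> g c"
    proof -
      have "t / (1 + t) + 1 / (1 + t) = 1"
        using t by (simp flip: add_divide_distrib)
      moreover have "x' \<in> Q"
        using x' eQ by blast
      moreover have "0 \<le> t / (1 + t)" "0 \<le> 1 / (1 + t)"
        using t by simp_all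
      ultimately have "t / (1 + t) * g x + 1 / (1 + t) * g x' \<le>
          g ((t / (1 + t)) *\<^sub>R x + (1 / (1 + t)) *\<^sub>R x')"
        using g x unfolding concave_on_iff by blast
      then show ?thesis
        unfolding c[symmetric] .
    qed
    then have "t * g x + g x' \<le> (1 + t) * g c"
      using t by (simp add: pos_divide_le_eq mult.commute flip: add_divide_distrib)
    moreover have "- g x' \<le> m" using m x' by blast
    ultimately show "g x \<le> ((1 + t) * g c + m) / t"
      using t by (simp add: field_simps)
  qed
qed

lemma absolutely_integrable_spike_interior:
  fixes g :: "'a::euclidean_space \<Rightarrow> real"
  assumes "convex Q"
  shows "g absolutely_integrable_on interior Q \<longleftrightarrow> g absolutely_integrable_on Q"
    and "integral (interior Q) g = integral Q g"
proof -
  have n: "negligible (Q - interior Q)"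
    using closure_subset by (intro negligible_subset[OF negligible_convex_frontier[OF assms]]) (auto simp: frontier_def)
  have *: "negligible {x \<in> interior Q - Q. g x \<noteq> 0}" "negligible {x \<in> Q - interior Q. g x \<noteq> 0}"
    using interior_subset[of Q] by (auto intro: negligible_subset[OF n] negligible_subset[OF negligible_empty])
  show "g absolutely_integrable_on interior Q \<longleftrightarrow> g absolutely_integrable_on Q"
    using * by (rule absolutely_integrable_spike_set_eq)
  show "integral (interior Q) g = integral Q g"
    using * by (rule integral_spike_set)
qed

lemma absolutely_integrable_bounded_continuous_interior:
  fixes g :: "'a::euclidean_space \<Rightarrow> real"
  assumes "convex Q" and "bounded Q" and "continuous_on (interior Q) g" and "bounded (g ` Q)"
  shows "g absolutely_integrable_on Q"
proof -
  obtain K where K: "\<And>x. x \<in> Q \<Longrightarrow> \<bar>g x\<bar> \<le> K"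
    using \<open>bounded (g ` Q)\<close> by (auto simp: bounded_iff)
  have "g absolutely_integrable_on interior Q"
  proof (rule measurable_bounded_by_integrable_imp_absolutely_integrable)
    show "g \<in> borel_measurable (lebesgue_on (interior Q))"
      using assms(3) by (intro continuous_imp_measurable_on_sets_lebesgue) auto
    show "(\<lambda>x. K) integrable_on interior Q"
      using \<open>bounded Q\<close> by (intro integrable_on_const lmeasurable_interior)
    show "norm (g x) \<le> K" if "x \<in> interior Q" for x
      using K that interior_subset by force
  qed auto
  then show ?thesis
    using absolutely_integrable_spike_interior \<open>convex Q\<close> by blast
qed

lemma concave_on_absolutely_integrable:
  fixes g :: "'a::euclidean_space \<Rightarrow> real"
  assumes g: "concave_on Q g" and "bounded Q" and "bdd_below (g ` Q)"
  shows "g absolutely_integrable_on Q"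
proof (cases "interior Q = {}")
  case True
  then have "negligible Q"
    using g concave_on_imp_convex negligible_convex_interior by blast
  then show ?thesis by (rule absolutely_integrable_negligible)
next
  case False
  then obtain M m where "\<And>x. x \<in> Q \<Longrightarrow> g x \<le> M" "\<And>x. x \<in> Q \<Longrightarrow> m \<le> g x"
    using concave_on_bdd_above[OF g \<open>bounded Q\<close>] \<open>bdd_below (g ` Q)\<close>
    by (auto simp: bdd_above_def bdd_below_def)
  then have "g ` Q \<subseteq> {m..M}" by auto
  then have "bounded (g ` Q)"
    using bounded_closed_interval bounded_subset by blast
  then show ?thesis
    using g \<open>bounded Q\<close> concave_on_imp_convex concave_on_continuous_interior
    by (intro absolutely_integrable_bounded_continuous_interior) auto
qed

section \<open>Volume of the perspective relaxation\<close>

lemma perspective_relaxation_eq: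
  assumes "convex_on Q f" "concave_on Q \<mu>"
  shows "perspective_relaxation \<mu> f Q = closure (truncated_cone (graph_region Q f \<mu>))"
proof -
  have "{(x, y, z). perspective \<mu> x z \<ge> y \<and> y \<ge> perspective f x z \<and>
      x \<in> (\<lambda>q. z *\<^sub>R q) ` Q \<and> 1 \<ge> z \<and> z > 0} = truncated_cone (graph_region Q f \<mu>)"
  proof -
    have "x \<in> (\<lambda>q. z *\<^sub>R q) ` Q \<longleftrightarrow> x /\<^sub>R z \<in> Q" if "0 < z" for x z
      using that by (force simp: image_iff)
    then show ?thesis
      by (auto simp: truncated_cone_def graph_region_def perspective_def field_simps)
  qed
  moreover have "convex (truncated_cone (graph_region Q f \<mu>))"
    using assms by (intro convex_truncated_cone convex_graph_region)
  ultimately show ?thesis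
    unfolding perspective_relaxation_def by (simp add: hull_same)
qed

theorem theorem2p1:
  fixes Q :: "(real ^ 'd) set" and f \<mu> :: "real ^ 'd \<Rightarrow> real"
  assumes "polytope Q"
    and "Q \<subseteq> {x. \<forall>i. 0 \<le> x $ i} - {0}"
    and "continuous_on Q f" and "convex_on Q f"
    and "concave_upper_bound Q f \<mu>"
  shows "measure lebesgue (perspective_relaxation \<mu> f Q) =
           1 / (real CARD('d) + 2) * (LINT x:Q|lebesgue. \<mu> x)
         - 1 / (real CARD('d) + 2) * (LINT x:Q|lebesgue. f x)"
proof -
  let ?O = "interior Q"
  have Q: "compact Q" "convex Q"
    using \<open>polytope Q\<close> by (auto simp: polytope_imp_compact polytope_imp_convex)
  have \<mu>: "concave_on Q \<mu>" and f_le: "\<And>x. x \<in> Q \<Longrightarrow> f x \<le> \<mu> x"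
    using assms(5) by (auto simp: concave_upper_bound_def)
  have cont: "continuous_on ?O f" "continuous_on ?O \<mu>"
    using \<open>continuous_on Q f\<close> interior_subset \<mu> continuous_on_subset concave_on_continuous_interior by blast+
  have "bounded (f ` Q)"
    using Q \<open>continuous_on Q f\<close> by (intro compact_imp_bounded compact_continuous_image)
  then have f: "f absolutely_integrable_on Q"
    using Q cont compact_imp_bounded by (intro absolutely_integrable_bounded_continuous_interior) auto
  have "bdd_below (f ` Q)"
    using \<open>bounded (f ` Q)\<close> by (rule bounded_imp_bdd_below)
  then obtain m where "\<And>x. x \<in> Q \<Longrightarrow> m \<le> f x"
    by (auto simp: bdd_below_def)
  then have "bdd_below (\<mu> ` Q)"
    using f_le by (intro bdd_belowI2[of _ m]) (meson order_trans)
  then have int: "\<mu> absolutely_integrable_on Q"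
    using \<mu> Q compact_imp_bounded by (intro concave_on_absolutely_integrable) auto
  have "frontier Q \<times> (UNIV :: real set) \<in> null_sets lborel"
  proof -
    have "frontier Q \<in> null_sets lborel"
      using negligible_convex_frontier[OF Q(2)] by (simp add: negligible_iff_null_sets null_sets_completion_iff)
    then have "frontier Q \<times> (UNIV :: real set) \<in> null_sets (lborel \<Otimes>\<^sub>M lborel)"
      by (auto simp: null_sets_def lborel.emeasure_pair_measure_Times)
    then show ?thesis by (simp add: lborel_prod)
  qed
  moreover have "graph_region Q f \<mu> \<subseteq> graph_region ?O f \<mu> \<union> frontier Q \<times> UNIV"
    using closure_subset by (auto simp: graph_region_def frontier_def)
  moreover have "graph_region ?O f \<mu> \<subseteq> graph_region Q f \<mu>"
    using interior_subset by (auto simp: graph_region_def)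
  ultimately have "measure lebesgue (perspective_relaxation \<mu> f Q) =
      measure lborel (graph_region ?O f \<mu>) / (real CARD('d) + 2)"
    using cont \<mu> \<open>convex_on Q f\<close> unfolding perspective_relaxation_eq[OF \<open>convex_on Q f\<close> \<mu>]
    by (subst measure_closure_truncated_cone) (auto intro!: graph_region_borel convex_graph_region)
  also have "measure lborel (graph_region ?O f \<mu>) = (LINT x:?O|lebesgue. \<mu> x - f x)"
  proof -
    have O: "(\<lambda>x. \<mu> x - f x) absolutely_integrable_on ?O"
      using f int Q by (intro set_integral_diff) (auto simp: absolutely_integrable_spike_interior)
    have "(LINT x:?O|lebesgue. \<mu> x - f x) =
        enn2real (\<integral>\<^sup>+x. ennreal (indicator ?O x * (\<mu> x - f x)) \<partial>lebesgue)"
      unfolding set_lebesgue_integral_def using O f_le interior_subset[of Q]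
      by (subst integral_eq_nn_integral) (auto simp: set_integrable_def indicator_def)
    also have "\<dots> = measure lborel (graph_region ?O f \<mu>)"
      using cont by (simp add: measure_def emeasure_graph_region nn_integral_completion)
    finally show ?thesis ..
  qed
  also have "\<dots> = (LINT x:?O|lebesgue. \<mu> x) - (LINT x:?O|lebesgue. f x)"
    using f int Q by (intro set_integral_diff) (auto simp: absolutely_integrable_spike_interior)
  also have "\<dots> = (LINT x:Q|lebesgue. \<mu> x) - (LINT x:Q|lebesgue. f x)"
    using f int Q by (simp add: set_lebesgue_integral_eq_integral absolutely_integrable_spike_interior)
  finally show ?thesis
    by (simp add: diff_divide_distrib)
qed

end
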